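(* Let $\alpha\in(0,2]$ and let $\xi$ be a full-dimensional $S\alpha S$ random vector in $\mathbb{R}^d$ with probability density $f$. Then, for all real $c\neq0$, $$\int_{\mathbb{R}^d}f(cx)f(x)\,dx=(1+|c|^\alpha)^{-d/\alpha}f(0).$$
   Context: A random vector $\xi\in\mathbb{R}^d$ is symmetric $\alpha$-stable ($S\alpha S$), $\alpha\in(0,2]$, if $\xi$ has the same distribution as $-\xi$ and $a^{1/\alpha}\xi_1+b^{1/\alpha}\xi_2$ has the same distribution as $(a+b)^{1/\alpha}\xi$ for all $a,b>0$, where $\xi_1,\xi_2$ are independent copies of $\xi$. Its characteristic function is $\mathbf{E}e^{i\langle\xi,u\rangle}=\exp\{-\int_{\mathbb{S}^{d-1}}|\langle u,z\rangle|^\alpha\sigma(dz)\}$ for a symmetric finite measure $\sigma$ (the spectral measure) on the Euclidean unit sphere. $\xi$ is full-dimensional if $\sigma$ is not concentrated on the intersection of $\mathbb{S}^{d-1}$ with a $(d-1)$-dimensional subspace; then $\xi$ has a density, and $f$ denotes its continuous version. *)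

theory Defs
  imports "HOL-Probability.Probability"
begin

text \<open>
  Independent copies of \<open>X\<close> are realised as the two coordinate copies
  \<open>X \<circ> fst\<close> and \<open>X \<circ> snd\<close> on the product probability space \<open>M \<Otimes>\<^sub>M M\<close>; the condition
  only concerns joint laws, so the choice of the copies is immaterial.
\<close>

definition symmetric_stable ::
    "real \<Rightarrow> 'w measure \<Rightarrow> ('w \<Rightarrow> 'a::euclidean_space) \<Rightarrow> bool" where
  "symmetric_stable \<alpha> M X \<longleftrightarrow>
     distr M borel X = distr M borel (\<lambda>w. - X w) \<and>
     (\<forall>a>0. \<forall>b>0.
        distr (M \<Otimes>\<^sub>M M) borel
          (\<lambda>w. (a powr (1 / \<alpha>)) *\<^sub>R X (fst w) + (b powr (1 / \<alpha>)) *\<^sub>R X (snd w)) =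
        distr M borel (\<lambda>w. ((a + b) powr (1 / \<alpha>)) *\<^sub>R X w))"

definition spectral_measure ::
    "real \<Rightarrow> 'w measure \<Rightarrow> ('w \<Rightarrow> 'a::euclidean_space) \<Rightarrow> 'a measure \<Rightarrow> bool" where
  "spectral_measure \<alpha> M X \<sigma> \<longleftrightarrow>
     sets \<sigma> = sets (restrict_space borel (sphere 0 1)) \<and>
     finite_measure \<sigma> \<and>
     distr \<sigma> \<sigma> uminus = \<sigma> \<and>
     (\<forall>u. (CLINT w|M. iexp (X w \<bullet> u)) =
          exp (- complex_of_real (LINT z|\<sigma>. \<bar>u \<bullet> z\<bar> powr \<alpha>)))"

text \<open>
  For \<open>\<alpha> = 2\<close> the measure \<open>\<sigma>\<close> is not unique, but the linear span of its support is determined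
  by the law of \<open>X\<close>, so the choice of \<open>\<sigma>\<close> does not matter.  If \<open>DIM('a) = 1\<close>, then \<open>V = {0}\<close>
  and the condition says that \<open>\<sigma>\<close> is not the zero measure.
\<close>

definition full_dimensional ::
    "real \<Rightarrow> 'w measure \<Rightarrow> ('w \<Rightarrow> 'a::euclidean_space) \<Rightarrow> bool" where
  "full_dimensional \<alpha> M X \<longleftrightarrow>
     (\<exists>\<sigma>. spectral_measure \<alpha> M X \<sigma> \<and>
          \<not> (\<exists>V. subspace V \<and> dim V = DIM('a) - 1 \<and> emeasure \<sigma> (sphere 0 1 - V) = 0))"

end

theory Submission
  imports Defs
begin

text \<open>
  The integral is the value at \<open>0\<close> of a convolution.  By symmetry \<open>c > 0\<close> may be assumed, and
  then \<open>h y = (\<integral>x. f x * f (y - c *\<^sub>R x))\<close> is a density of \<open>c X\<^sub>1 + X\<^sub>2\<close> for independent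
  copies \<open>X\<^sub>1\<close>, \<open>X\<^sub>2\<close> of \<open>X\<close>.  Stability says that this vector has the law of \<open>s X\<close> with
  \<open>s = (1 + c powr \<alpha>) powr (1 / \<alpha>)\<close>, whose density is \<open>f (y / s) / s ^ d\<close>.  Hence the two
  densities agree for almost every \<open>y\<close> (\<open>symmetric_stable_convolution_AE\<close>), and the claim is
  their equality at the single point \<open>y = 0\<close>, where \<open>f\<close> being even turns \<open>h 0\<close> into the
  integral in question.

  Passing from almost every point to every point requires \<open>h\<close> to be continuous.  Dominated
  convergence gives this once \<open>f\<close> is bounded, and boundedness is obtained from stability itself,
  without Fourier inversion.  Along points \<open>y\<^sub>n \<rightarrow> y\<close> where the densities agree, Fatou's lemma
  already yields \<open>h y \<le> f (y / s) / s ^ d\<close> everywhere.  For \<open>c = 1\<close> and \<open>y = 0\<close> this bounds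
  \<open>\<integral>x. (f x)\<^sup>2\<close>, so \<open>f\<close> is square integrable; the convolution of two square integrable
  functions is bounded, and therefore so is its rescaling \<open>f\<close>
  (\<open>symmetric_stable_density_bounded\<close>).
\<close>

section \<open>From almost every point to every point\<close>

text \<open>
  A set of full Lebesgue measure meets every ball and is therefore dense.  Statements that hold
  almost everywhere are transferred to individual points along such sequences.
\<close>

lemma AE_lborel_imp_sequence:
  fixes y :: "'a::euclidean_space"
  assumes "AE x in lborel. P x"
  obtains u where "\<And>n::nat. P (u n)" "u \<longlonglongrightarrow> y"
proof -
  have "AE x in lebesgue. x \<in> closure {x. P x}"
    using AE_completion[OF assms] by eventually_elim (auto intro: subsetD[OF closure_subset])
  then have "y \<in> closure {x. P x}"
    by (rule mem_closed_if_AE_lebesgue[OF closed_closure])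
  then show ?thesis
    using that unfolding closure_sequential by auto
qed

lemma AE_lborel_eq_imp_eq:
  fixes f g :: "'a::euclidean_space \<Rightarrow> real"
  assumes "AE x in lborel. f x = g x" "continuous_on UNIV f" "continuous_on UNIV g"
  shows "f x = g x"
proof -
  have "closed {x. f x = g x}"
    using assms(2,3) by (intro closed_Collect_eq) auto
  moreover have "AE x in lebesgue. x \<in> {x. f x = g x}"
    using AE_completion[OF assms(1)] by simp
  ultimately show ?thesis
    using mem_closed_if_AE_lebesgue by blast
qed

section \<open>Densities of multiples and of independent sums\<close>

lemma nn_integral_lborel_affine:
  fixes t :: "'a::euclidean_space" and c :: real
  assumes [measurable]: "h \<in> borel_measurable borel" and c: "c \<noteq> 0"
  shows "(\<integral>\<^sup>+x. h x \<partial>lborel) = ennreal (\<bar>c\<bar> ^ DIM('a)) * (\<integral>\<^sup>+x. h (t + c *\<^sub>R x) \<partial>lborel)"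
  by (subst lborel_affine[OF c, of t])
     (simp add: nn_integral_density nn_integral_distr nn_integral_cmult)

lemma distr_scaleR_eq_density:
  fixes X :: "'w \<Rightarrow> 'a::euclidean_space"
  assumes X: "distributed M lborel X (\<lambda>x. ennreal (f x))"
    and [measurable]: "f \<in> borel_measurable borel" and s: "s \<noteq> 0"
  shows "distr M borel (\<lambda>w. s *\<^sub>R X w) =
    density lborel (\<lambda>y. ennreal (f (y /\<^sub>R s) / \<bar>s\<bar> ^ DIM('a)))"
proof (rule measure_eqI)
  have [measurable]: "X \<in> borel_measurable M"
    using distributed_measurable[OF X] by simp
  fix A assume "A \<in> sets (distr M borel (\<lambda>w. s *\<^sub>R X w))"
  then have [measurable]: "A \<in> sets borel" by simp
  have jacobian: "ennreal (\<bar>inverse s\<bar> ^ DIM('a)) * ennreal r = ennreal (r / \<bar>s\<bar> ^ DIM('a))" for r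
    by (subst ennreal_mult'[symmetric]) (simp_all add: divide_inverse power_inverse mult.commute)
  have "emeasure (distr M borel (\<lambda>w. s *\<^sub>R X w)) A = (\<integral>\<^sup>+w. indicator A (s *\<^sub>R X w) \<partial>M)"
    by (subst nn_integral_indicator[symmetric], simp, subst nn_integral_distr) auto
  also have "\<dots> = (\<integral>\<^sup>+x. ennreal (f x) * indicator A (s *\<^sub>R x) \<partial>lborel)"
    by (rule distributed_nn_integral[OF X, symmetric]) simp
  also have "\<dots> = ennreal (\<bar>inverse s\<bar> ^ DIM('a)) *
      (\<integral>\<^sup>+y. ennreal (f (0 + inverse s *\<^sub>R y)) * indicator A (s *\<^sub>R (0 + inverse s *\<^sub>R y)) \<partial>lborel)"
    using s by (intro nn_integral_lborel_affine) auto
  also have "\<dots> = (\<integral>\<^sup>+y. ennreal (\<bar>inverse s\<bar> ^ DIM('a)) *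
      (ennreal (f (0 + inverse s *\<^sub>R y)) * indicator A (s *\<^sub>R (0 + inverse s *\<^sub>R y))) \<partial>lborel)"
    by (subst nn_integral_cmult) auto
  also have "\<dots> = (\<integral>\<^sup>+y. ennreal (f (y /\<^sub>R s) / \<bar>s\<bar> ^ DIM('a)) * indicator A y \<partial>lborel)"
    using s by (intro nn_integral_cong) (simp add: jacobian mult.assoc[symmetric] del: abs_inverse)
  also have "\<dots> = emeasure (density lborel (\<lambda>y. ennreal (f (y /\<^sub>R s) / \<bar>s\<bar> ^ DIM('a)))) A"
    by (subst emeasure_density) auto
  finally show "emeasure (distr M borel (\<lambda>w. s *\<^sub>R X w)) A =
    emeasure (density lborel (\<lambda>y. ennreal (f (y /\<^sub>R s) / \<bar>s\<bar> ^ DIM('a)))) A" .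
qed simp

text \<open>
  Tonelli's theorem and the substitution \<open>y = c *\<^sub>R x + z\<close> in the inner integral.  The density
  is kept as an extended nonnegative integral, because at an individual point \<open>y\<close> it could be
  infinite as long as \<open>f\<close> is not known to be bounded.
\<close>

lemma distr_independent_sum_eq_density:
  fixes X :: "'w \<Rightarrow> 'a::euclidean_space"
  assumes M: "prob_space M" and X: "distributed M lborel X (\<lambda>x. ennreal (f x))"
    and [measurable]: "f \<in> borel_measurable borel" and nonneg: "\<And>x. 0 \<le> f x"
  shows "distr (M \<Otimes>\<^sub>M M) borel (\<lambda>w. c *\<^sub>R X (fst w) + X (snd w)) =
    density lborel (\<lambda>y. \<integral>\<^sup>+x. ennreal (f x * f (y - c *\<^sub>R x)) \<partial>lborel)"
proof (rule measure_eqI)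
  interpret prob_space M by (rule M)
  have [measurable]: "X \<in> borel_measurable M"
    using distributed_measurable[OF X] by simp
  fix A assume "A \<in> sets (distr (M \<Otimes>\<^sub>M M) borel (\<lambda>w. c *\<^sub>R X (fst w) + X (snd w)))"
  then have [measurable]: "A \<in> sets borel" by simp
  have translate: "(\<integral>\<^sup>+z. ennreal (f z) * indicator A (c *\<^sub>R x + z) \<partial>lborel) =
      (\<integral>\<^sup>+y. ennreal (f (y - c *\<^sub>R x)) * indicator A y \<partial>lborel)" for x
    by (subst nn_integral_lborel_affine[where c=1 and t="- c *\<^sub>R x"]) auto
  have "emeasure (distr (M \<Otimes>\<^sub>M M) borel (\<lambda>w. c *\<^sub>R X (fst w) + X (snd w))) A =
      (\<integral>\<^sup>+w. indicator A (c *\<^sub>R X (fst w) + X (snd w)) \<partial>(M \<Otimes>\<^sub>M M))"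
    by (subst nn_integral_indicator[symmetric], simp, subst nn_integral_distr) auto
  also have "\<dots> = (\<integral>\<^sup>+v. (\<integral>\<^sup>+w. indicator A (c *\<^sub>R X v + X w) \<partial>M) \<partial>M)"
    by (subst nn_integral_fst[symmetric]) auto
  also have "\<dots> = (\<integral>\<^sup>+v. (\<integral>\<^sup>+z. ennreal (f z) * indicator A (c *\<^sub>R X v + z) \<partial>lborel) \<partial>M)"
    by (intro nn_integral_cong distributed_nn_integral[OF X, symmetric]) simp
  also have "\<dots> = (\<integral>\<^sup>+x. ennreal (f x) *
      (\<integral>\<^sup>+z. ennreal (f z) * indicator A (c *\<^sub>R x + z) \<partial>lborel) \<partial>lborel)"
    by (rule distributed_nn_integral[OF X, symmetric]) simp
  also have "\<dots> = (\<integral>\<^sup>+x. ennreal (f x) *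
      (\<integral>\<^sup>+y. ennreal (f (y - c *\<^sub>R x)) * indicator A y \<partial>lborel) \<partial>lborel)"
    by (simp only: translate)
  also have "\<dots> = (\<integral>\<^sup>+x. (\<integral>\<^sup>+y. ennreal (f x * f (y - c *\<^sub>R x)) * indicator A y \<partial>lborel) \<partial>lborel)"
    by (subst nn_integral_cmult[symmetric]) (auto simp: ennreal_mult' nonneg mult.assoc)
  also have "\<dots> = (\<integral>\<^sup>+y. (\<integral>\<^sup>+x. ennreal (f x * f (y - c *\<^sub>R x)) * indicator A y \<partial>lborel) \<partial>lborel)"
    by (rule lborel_pair.Fubini') simp
  also have "\<dots> = (\<integral>\<^sup>+y. (\<integral>\<^sup>+x. ennreal (f x * f (y - c *\<^sub>R x)) \<partial>lborel) * indicator A y \<partial>lborel)"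
    by (subst nn_integral_multc) auto
  also have "\<dots> = emeasure (density lborel
      (\<lambda>y. \<integral>\<^sup>+x. ennreal (f x * f (y - c *\<^sub>R x)) \<partial>lborel)) A"
    by (subst emeasure_density) auto
  finally show "emeasure (distr (M \<Otimes>\<^sub>M M) borel (\<lambda>w. c *\<^sub>R X (fst w) + X (snd w))) A =
    emeasure (density lborel (\<lambda>y. \<integral>\<^sup>+x. ennreal (f x * f (y - c *\<^sub>R x)) \<partial>lborel)) A" .
qed simp

section \<open>Stability in terms of the density\<close>

lemma symmetric_stable_density_even:
  fixes X :: "'w \<Rightarrow> 'a::euclidean_space"
  assumes stable: "symmetric_stable \<alpha> M X"
    and X: "distributed M lborel X (\<lambda>x. ennreal (f x))"
    and nonneg: "\<And>x. 0 \<le> f x" and cont: "continuous_on UNIV f"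
  shows "f (- x) = f x"
proof -
  have [measurable]: "f \<in> borel_measurable borel"
    using cont by (rule borel_measurable_continuous_onI)
  have "density lborel (\<lambda>y. ennreal (f (- y))) = distr M borel (\<lambda>w. - X w)"
    using distr_scaleR_eq_density[OF X, of "-1"] by simp
  also have "\<dots> = distr M lborel X"
    using stable by (simp add: symmetric_stable_def cong: distr_cong)
  also have "\<dots> = density lborel (\<lambda>x. ennreal (f x))"
    by (rule distributed_distr_eq_density[OF X])
  finally have "AE x in lborel. ennreal (f (- x)) = ennreal (f x)"
    by (intro sigma_finite_measure.density_unique[OF lborel.sigma_finite_measure_axioms]) auto
  then have "AE x in lborel. f (- x) = f x"
    using nonneg by simp
  moreover have "continuous_on UNIV (\<lambda>x. f (- x))"
    by (intro continuous_on_compose2[OF cont] continuous_intros) auto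
  ultimately show ?thesis
    using cont by (rule AE_lborel_eq_imp_eq)
qed

text \<open>
  The defining relation of stability with weights \<open>c powr \<alpha>\<close> and \<open>1\<close>, read off on both sides as
  an equality of densities.
\<close>

lemma symmetric_stable_convolution_AE:
  fixes X :: "'w \<Rightarrow> 'a::euclidean_space"
  assumes \<alpha>: "0 < \<alpha>" and M: "prob_space M" and stable: "symmetric_stable \<alpha> M X"
    and X: "distributed M lborel X (\<lambda>x. ennreal (f x))"
    and [measurable]: "f \<in> borel_measurable borel" and nonneg: "\<And>x. 0 \<le> f x"
    and c: "0 < c"
  defines "s \<equiv> (1 + c powr \<alpha>) powr (1 / \<alpha>)"
  shows "AE y in lborel. (\<integral>\<^sup>+x. ennreal (f x * f (y - c *\<^sub>R x)) \<partial>lborel) =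
    ennreal (f (y /\<^sub>R s) / s ^ DIM('a))"
proof -
  have s: "0 < s"
    unfolding s_def by (smt (verit) powr_gt_zero powr_ge_zero)
  have "density lborel (\<lambda>y. \<integral>\<^sup>+x. ennreal (f x * f (y - c *\<^sub>R x)) \<partial>lborel) =
      distr (M \<Otimes>\<^sub>M M) borel (\<lambda>w. c *\<^sub>R X (fst w) + X (snd w))"
    using distr_independent_sum_eq_density[OF M X _ nonneg] by simp
  also have "\<dots> = distr M borel (\<lambda>w. s *\<^sub>R X w)"
  proof -
    have "distr (M \<Otimes>\<^sub>M M) borel (\<lambda>w. ((c powr \<alpha>) powr (1 / \<alpha>)) *\<^sub>R X (fst w) +
        (1 powr (1 / \<alpha>)) *\<^sub>R X (snd w)) =
      distr M borel (\<lambda>w. ((c powr \<alpha> + 1) powr (1 / \<alpha>)) *\<^sub>R X w)"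
      using stable c unfolding symmetric_stable_def by (simp del: powr_one_eq_one)
    then show ?thesis
      using \<alpha> c by (simp add: s_def powr_powr add.commute)
  qed
  also have "\<dots> = density lborel (\<lambda>y. ennreal (f (y /\<^sub>R s) / s ^ DIM('a)))"
    using distr_scaleR_eq_density[OF X, of s] s by simp
  finally show ?thesis
    by (intro sigma_finite_measure.density_unique[OF lborel.sigma_finite_measure_axioms]) auto
qed

section \<open>Boundedness of the density\<close>

text \<open>
  The integrand is nonnegative and continuous in \<open>y\<close>, so by Fatou's lemma the convolution is
  lower semicontinuous; this is the inequality available before \<open>f\<close> is known to be bounded.
\<close>

lemma convolution_le_if_AE_eq:
  fixes f g :: "'a::euclidean_space \<Rightarrow> real"
  assumes cont: "continuous_on UNIV f" and nonneg: "\<And>x. 0 \<le> f x"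
    and g: "continuous_on UNIV g"
    and ae: "AE y in lborel. (\<integral>\<^sup>+x. ennreal (f x * f (y - c *\<^sub>R x)) \<partial>lborel) = ennreal (g y)"
  shows "(\<integral>\<^sup>+x. ennreal (f x * f (y - c *\<^sub>R x)) \<partial>lborel) \<le> ennreal (g y)"
proof -
  have [measurable]: "f \<in> borel_measurable borel"
    using cont by (rule borel_measurable_continuous_onI)
  obtain u where u: "\<And>n::nat. (\<integral>\<^sup>+x. ennreal (f x * f (u n - c *\<^sub>R x)) \<partial>lborel) = ennreal (g (u n))"
    and lim: "u \<longlonglongrightarrow> y"
    using AE_lborel_imp_sequence[OF ae] by blast
  have flim: "(\<lambda>n. ennreal (f x * f (u n - c *\<^sub>R x))) \<longlonglongrightarrow> ennreal (f x * f (y - c *\<^sub>R x))" for x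
    by (intro tendsto_intros tendsto_ennrealI continuous_on_tendsto_compose[OF cont] lim) auto
  have glim: "(\<lambda>n. ennreal (g (u n))) \<longlonglongrightarrow> ennreal (g y)"
    by (intro tendsto_ennrealI continuous_on_tendsto_compose[OF g] lim) auto
  have "(\<integral>\<^sup>+x. ennreal (f x * f (y - c *\<^sub>R x)) \<partial>lborel) =
      (\<integral>\<^sup>+x. liminf (\<lambda>n. ennreal (f x * f (u n - c *\<^sub>R x))) \<partial>lborel)"
    by (simp add: lim_imp_Liminf[OF _ flim])
  also have "\<dots> \<le> liminf (\<lambda>n. \<integral>\<^sup>+x. ennreal (f x * f (u n - c *\<^sub>R x)) \<partial>lborel)"
    by (intro nn_integral_liminf) simp
  also have "\<dots> = ennreal (g y)"
    by (simp add: u lim_imp_Liminf[OF _ glim])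
  finally show ?thesis .
qed

text \<open>
  Stability with \<open>c = 1\<close> is used twice.  Evaluated at \<open>0\<close>, where the convolution of the even
  function \<open>f\<close> with itself is \<open>\<integral>x. (f x)\<^sup>2\<close>, it shows that \<open>f\<close> is square integrable; evaluated
  at arbitrary points, it expresses \<open>f\<close> as a rescaled convolution of square integrable
  functions, which is bounded.
\<close>

lemma symmetric_stable_density_bounded:
  fixes X :: "'w \<Rightarrow> 'a::euclidean_space"
  assumes \<alpha>: "0 < \<alpha>" and M: "prob_space M" and stable: "symmetric_stable \<alpha> M X"
    and X: "distributed M lborel X (\<lambda>x. ennreal (f x))"
    and nonneg: "\<And>x. 0 \<le> f x" and cont: "continuous_on UNIV f"
  obtains B where "\<And>x. f x \<le> B"
proof -
  have [measurable]: "f \<in> borel_measurable borel"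
    using cont by (rule borel_measurable_continuous_onI)
  have even: "f (- x) = f x" for x
    using symmetric_stable_density_even[OF stable X nonneg cont] .
  define s where "s = (1 + 1 powr \<alpha>) powr (1 / \<alpha>)"
  have s: "0 < s"
    by (simp add: s_def)
  define g where "g y = f (y /\<^sub>R s) / s ^ DIM('a)" for y
  have g: "continuous_on UNIV g"
    unfolding g_def using s
    by (intro continuous_intros continuous_on_compose2[OF cont]) auto
  have ae: "AE y in lborel. (\<integral>\<^sup>+x. ennreal (f x * f (y - 1 *\<^sub>R x)) \<partial>lborel) = ennreal (g y)"
    unfolding g_def s_def
    using symmetric_stable_convolution_AE[OF \<alpha> M stable X _ nonneg, of 1] by simp
  have conv_le: "(\<integral>\<^sup>+x. ennreal (f x * f (y - x)) \<partial>lborel) \<le> ennreal (g y)" for y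
    using convolution_le_if_AE_eq[OF cont nonneg g ae, of y] by simp
  define Q where "Q = (\<integral>\<^sup>+x. ennreal ((f x)\<^sup>2) \<partial>lborel)"
  have Q: "Q \<le> ennreal (g 0)"
    using conv_le[of 0] by (simp add: Q_def even power2_eq_square)
  have shift: "(\<integral>\<^sup>+x. ennreal ((f (y - x))\<^sup>2) \<partial>lborel) = Q" for y
    unfolding Q_def by (subst (2) nn_integral_lborel_affine[where c="-1" and t=y]) auto
  \<comment> \<open>Since \<open>a * b \<le> a\<^sup>2 + b\<^sup>2\<close> and reflected translates of \<open>f\<close> have the same \<open>L\<^sup>2\<close> norm, the
    convolution is bounded; the factor \<open>2\<close> is not optimal.\<close>
  have bound: "(\<integral>\<^sup>+x. ennreal (f x * f (y - x)) \<partial>lborel) \<le> 2 * ennreal (g 0)" for y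
  proof -
    have "f x * f (y - x) \<le> (f x)\<^sup>2 + (f (y - x))\<^sup>2" for x
      using sum_squares_bound[of "f x" "f (y - x)"] mult_nonneg_nonneg[OF nonneg nonneg, of x "y - x"]
      by linarith
    then have "(\<integral>\<^sup>+x. ennreal (f x * f (y - x)) \<partial>lborel) \<le>
        (\<integral>\<^sup>+x. ennreal ((f x)\<^sup>2) + ennreal ((f (y - x))\<^sup>2) \<partial>lborel)"
      by (intro nn_integral_mono) (simp add: ennreal_plus[symmetric] del: ennreal_plus)
    also have "\<dots> = Q + Q"
      by (subst nn_integral_add) (auto simp: shift Q_def)
    also have "\<dots> \<le> 2 * ennreal (g 0)"
      using add_mono[OF Q Q] by (simp add: mult_2)
    finally show ?thesis .
  qed
  have g0: "0 \<le> g 0"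
    using nonneg s by (simp add: g_def)
  have "AE y in lborel. y \<in> {y. g y \<le> 2 * g 0}"
    using ae
  proof eventually_elim
    case (elim y)
    then have "ennreal (g y) \<le> ennreal (2 * g 0)"
      using bound[of y] g0 by (simp add: ennreal_mult')
    then show ?case
      using g0 by (simp add: ennreal_le_iff)
  qed
  then have "AE y in lebesgue. y \<in> {y. g y \<le> 2 * g 0}"
    by (rule AE_completion)
  moreover have "closed {y. g y \<le> 2 * g 0}"
    using g by (intro closed_Collect_le) auto
  ultimately have le: "g y \<le> 2 * g 0" for y
    using mem_closed_if_AE_lebesgue by blast
  have "f x \<le> 2 * g 0 * s ^ DIM('a)" for x
    using le[of "s *\<^sub>R x"] s by (simp add: g_def field_simps)
  then show ?thesis
    by (rule that)
qed

section \<open>Continuity of the convolution and its value at the origin\<close>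

text \<open>
  For bounded \<open>f\<close> the integrands are dominated by \<open>B * f x\<close> uniformly in \<open>y\<close>, so the convolution
  is continuous and equality almost everywhere becomes equality everywhere.
\<close>

lemma convolution_eq_if_AE_eq_bounded:
  fixes f g :: "'a::euclidean_space \<Rightarrow> real"
  assumes cont: "continuous_on UNIV f" and nonneg: "\<And>x. 0 \<le> f x"
    and int: "integrable lborel f" and bdd: "\<And>x. f x \<le> B"
    and g: "continuous_on UNIV g" and g_nonneg: "\<And>y. 0 \<le> g y"
    and ae: "AE y in lborel. (\<integral>\<^sup>+x. ennreal (f x * f (y - c *\<^sub>R x)) \<partial>lborel) = ennreal (g y)"
  shows "has_bochner_integral lborel (\<lambda>x. f x * f (y - c *\<^sub>R x)) (g y)"
proof -
  have [measurable]: "f \<in> borel_measurable borel"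
    using cont by (rule borel_measurable_continuous_onI)
  obtain u where u: "\<And>n::nat. (\<integral>\<^sup>+x. ennreal (f x * f (u n - c *\<^sub>R x)) \<partial>lborel) = ennreal (g (u n))"
    and lim: "u \<longlonglongrightarrow> y"
    using AE_lborel_imp_sequence[OF ae] by blast
  have dom: "norm (f x * f (z - c *\<^sub>R x)) \<le> B * f x" for x z
    using mult_left_mono[OF bdd nonneg, of x "z - c *\<^sub>R x"] nonneg by (simp add: mult.commute)
  have "(\<lambda>n. \<integral>x. f x * f (u n - c *\<^sub>R x) \<partial>lborel) \<longlonglongrightarrow> (\<integral>x. f x * f (y - c *\<^sub>R x) \<partial>lborel)"
  proof (rule integral_dominated_convergence[where w="\<lambda>x. B * f x"])
    show "AE x in lborel. (\<lambda>n. f x * f (u n - c *\<^sub>R x)) \<longlonglongrightarrow> f x * f (y - c *\<^sub>R x)"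
      by (intro AE_I2 tendsto_intros continuous_on_tendsto_compose[OF cont] lim) auto
  qed (use int dom in auto)
  moreover have "(\<integral>x. f x * f (u n - c *\<^sub>R x) \<partial>lborel) = g (u n)" for n
    using u[of n] nonneg g_nonneg by (subst integral_eq_nn_integral) auto
  moreover have "(\<lambda>n. g (u n)) \<longlonglongrightarrow> g y"
    by (intro continuous_on_tendsto_compose[OF g] lim) auto
  ultimately have "(\<integral>x. f x * f (y - c *\<^sub>R x) \<partial>lborel) = g y"
    using LIMSEQ_unique by auto
  moreover have "integrable lborel (\<lambda>x. f x * f (y - c *\<^sub>R x))"
    by (rule Bochner_Integration.integrable_bound[where f="\<lambda>x. B * f x"])
       (use int dom in \<open>auto intro: order_trans[OF _ abs_ge_self]\<close>)
  ultimately show ?thesis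
    by (simp add: has_bochner_integral_iff)
qed

theorem theorem5p1:
  fixes \<alpha> c :: real
    and M :: "'w measure"
    and X :: "'w \<Rightarrow> 'a::euclidean_space"
    and f :: "'a \<Rightarrow> real"
  assumes "0 < \<alpha>" and "\<alpha> \<le> 2"
    and "prob_space M"
    and "X \<in> borel_measurable M"
    and "symmetric_stable \<alpha> M X"
    and "full_dimensional \<alpha> M X"
    and "distributed M lborel X (\<lambda>x. ennreal (f x))"
    and "\<And>x. 0 \<le> f x"
    and "continuous_on UNIV f"
    and "c \<noteq> 0"
  shows "has_bochner_integral lborel (\<lambda>x. f (c *\<^sub>R x) * f x)
           ((1 + \<bar>c\<bar> powr \<alpha>) powr (- (real DIM('a) / \<alpha>)) * f 0)"
proof -
  note nonneg = assms(8) and cont = assms(9)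
  have [measurable]: "f \<in> borel_measurable borel"
    using cont by (rule borel_measurable_continuous_onI)
  have even: "f (- x) = f x" for x
    using symmetric_stable_density_even[OF assms(5,7) nonneg cont] .
  obtain B where B: "\<And>x. f x \<le> B"
    using symmetric_stable_density_bounded[OF assms(1,3,5,7) nonneg cont] by blast
  interpret prob_space M by (rule assms(3))
  have int: "integrable lborel f"
    using distributed_integrable[OF assms(7), of "\<lambda>_. 1 :: real"] nonneg by simp
  define s where "s = (1 + \<bar>c\<bar> powr \<alpha>) powr (1 / \<alpha>)"
  have s: "0 < s"
    unfolding s_def by (smt (verit) powr_gt_zero powr_ge_zero)
  define g where "g y = f (y /\<^sub>R s) / s ^ DIM('a)" for y
  have "continuous_on UNIV g"
    unfolding g_def using s
    by (intro continuous_intros continuous_on_compose2[OF cont]) auto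
  moreover have "0 \<le> g y" for y
    using nonneg s by (simp add: g_def)
  moreover have "AE y in lborel.
      (\<integral>\<^sup>+x. ennreal (f x * f (y - \<bar>c\<bar> *\<^sub>R x)) \<partial>lborel) = ennreal (g y)"
    unfolding g_def s_def
    using symmetric_stable_convolution_AE[OF assms(1,3,5,7) _ nonneg, of "\<bar>c\<bar>"] assms(10) by simp
  ultimately have "has_bochner_integral lborel (\<lambda>x. f x * f (0 - \<bar>c\<bar> *\<^sub>R x)) (g 0)"
    by (rule convolution_eq_if_AE_eq_bounded[OF cont nonneg int B])
  \<comment> \<open>Evenness replaces both the sign in \<open>0 - \<bar>c\<bar> *\<^sub>R x\<close> and the absolute value.\<close>
  moreover have "(\<lambda>x. f x * f (0 - \<bar>c\<bar> *\<^sub>R x)) = (\<lambda>x. f (c *\<^sub>R x) * f x)"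
    by (cases "0 \<le> c") (auto simp: even fun_eq_iff)
  moreover have "g 0 = (1 + \<bar>c\<bar> powr \<alpha>) powr (- (real DIM('a) / \<alpha>)) * f 0"
  proof -
    have "s ^ DIM('a) = (1 + \<bar>c\<bar> powr \<alpha>) powr (real DIM('a) / \<alpha>)"
      using s by (subst powr_realpow[symmetric]) (auto simp: s_def powr_powr)
    then show ?thesis
      by (simp add: g_def powr_minus divide_inverse)
  qed
  ultimately show ?thesis
    by (simp only:)
qed

end
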